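(* The constant $q_*$ satisfies $$0.1150549835233248474484387814301602327073195692204367998530110<q_*<0.1150549835233248474484387815240548332602930857594706272107345 .$$
   Context: Put $b(x)=\frac{x^3}{3}-4x+\frac{11}{3}$, $\psi(x,y)=\frac{(x+y)^3}{3}+\frac{2x^3}{3}-6x-4y+\frac{20}{3}$ and $\mathcal J(w)=b(w_0)+\sum_{j\ge0}\psi(w_j,w_{j+1})$. Let $w^*=(w_j^* )_{j\ge0}$ be the unique positive sequence with $3(w_0^* )^2+(w_0^*+w_1^* )^2=10$, $(w_{j-1}^*+w_j^* )^2+(w_j^*+w_{j+1}^* )^2+2(w_j^* )^2=10$ for $j\ge1$, and $w_j^*\to1$; equivalently $w^*$ is the unique minimizer of $\mathcal J$ over nonnegative sequences $w$ with $w-1\in\ell^2(\mathbb N_0)$. Then $q_*:=\frac7{48}+\frac1{16}\mathcal J(w^* )$. *)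

theory Defs
  imports "HOL-Analysis.Analysis"
begin

definition b :: "real \<Rightarrow> real" where
  "b x = x ^ 3 / 3 - 4 * x + 11 / 3"

definition psi :: "real \<Rightarrow> real \<Rightarrow> real" where
  "psi x y = (x + y) ^ 3 / 3 + 2 * x ^ 3 / 3 - 6 * x - 4 * y + 20 / 3"

text \<open>
  The point (1, 1) is a zero and a critical point of psi, so the series converges
  absolutely whenever w - 1 is square summable; otherwise the value of suminf may be junk.
\<close>
definition J :: "(nat \<Rightarrow> real) \<Rightarrow> real" where
  "J w = b (w 0) + (\<Sum>j. psi (w j) (w (Suc j)))"

definition stationary_sequence :: "(nat \<Rightarrow> real) \<Rightarrow> bool" where
  "stationary_sequence w \<longleftrightarrow>
     (\<forall>j. w j > 0) \<and>
     3 * (w 0)\<^sup>2 + (w 0 + w 1)\<^sup>2 = 10 \<and>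
     (\<forall>j\<ge>1. (w (j - 1) + w j)\<^sup>2 + (w j + w (j + 1))\<^sup>2 + 2 * (w j)\<^sup>2 = 10) \<and>
     w \<longlonglongrightarrow> 1"

text \<open>
  The definite description presupposes that exactly one stationary sequence exists; this is
  not assumed anywhere, so facts about \<open>w_star\<close> require a proof of it.
\<close>
definition w_star :: "nat \<Rightarrow> real" where
  "w_star = (THE w. stationary_sequence w)"

definition q_star :: real where
  "q_star = 7 / 48 + J w_star / 16"

end

theory Submission
  imports Defs
begin

text \<open>
  On nonnegative sequences \<^term>\<open>J\<close> is convex, and the equations that define a stationary
  sequence say that its gradient vanishes. More precisely, the cubic \<open>x\<^sup>3 / 3\<close> lies above its
  tangent at \<open>x\<close> by at least \<open>2 / 3 * x * h\<^sup>2\<close> (lemma \<open>cube_lower_quadratic\<close>), so the truncation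
  of \<^term>\<open>J\<close> after finitely many terms lies above its tangent at \<open>v\<close> by at least
  \<open>4 / 3 * v j * (h j)\<^sup>2\<close> in every coordinate, up to one boundary term that vanishes in the limit
  when both sequences tend to 1 (\<open>J_part_lower\<close>). This one inequality has four uses.

  \<^item> Applied to two stationary sequences in both directions, it forces them to coincide.
  \<^item> With base point a nonnegative critical sequence \<open>w\<close>, compared with the constant sequence 1, it
    bounds the partial sums of the series in \<^term>\<open>J\<close>. The terms dominate \<open>(w j - 1)\<^sup>2\<close>, so the
    series converges and \<open>w\<close> tends to 1 by itself.
  \<^item> With base point \<open>w\<close>, compared with a trial sequence \<open>v\<close> that is eventually 1, it gives
    \<open>J w \<le> J v\<close>.
  \<^item> With base point \<open>v\<close>, after completing the square in every coordinate, it gives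
    \<open>J v - C * (\<Sum>j. (grad v j)\<^sup>2) \<le> J w\<close>, where \<open>C\<close> depends only on a positive lower bound for \<open>v\<close>.

  The last two estimates enclose \<open>J w\<close> in terms of \<open>v\<close> alone, without any bound on \<open>w - v\<close>, and the
  error is quadratic in the residual of \<open>v\<close>. As the linearised recurrence
  \<open>u (j - 1) + 3 * u j + u (j + 1) = 0\<close> decays like \<open>0.382 ^ j\<close>, a trial sequence with 34
  entries of 16 decimals has a residual of norm about \<open>10 ^ -14\<close> and determines the constant to 28 decimals.

  A positive critical sequence exists because a gradient step of length \<open>1 / 20\<close> maps the sequences
  with entries in \<open>[1/2, 8/5]\<close> to themselves and contracts the supremum distance by \<open>9 / 10\<close>
  (\<open>descend_in_box\<close>, \<open>descend_contraction\<close>): each row of the Hessian is dominated by its diagonal.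
\<close>

section \<open>The gradient and the truncated functional\<close>

text \<open>
  Reading the missing left neighbour of \<open>w 0\<close> as 0 gives the first equation the same form as the
  others. The boundary term of the truncated functional is also expressed by this quantity.
\<close>
fun incoming :: "(nat \<Rightarrow> real) \<Rightarrow> nat \<Rightarrow> real" where
  "incoming w 0 = (w 0)\<^sup>2"
| "incoming w (Suc j) = (w j + w (Suc j))\<^sup>2"

definition grad :: "(nat \<Rightarrow> real) \<Rightarrow> nat \<Rightarrow> real" where
  "grad w j = incoming w j + incoming w (Suc j) + 2 * (w j)\<^sup>2 - 10"

definition J_part :: "nat \<Rightarrow> (nat \<Rightarrow> real) \<Rightarrow> real" where
  "J_part n w = b (w 0) + (\<Sum>j<n. psi (w j) (w (Suc j)))"

text \<open>The gap to the left-hand side is exactly \<open>y * (y - x)\<^sup>2 / 3\<close>.\<close>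
lemma cube_lower_quadratic:
  fixes x y :: real
  assumes "x \<ge> 0" "y \<ge> 0"
  shows "x ^ 3 / 3 + x\<^sup>2 * (y - x) + 2 / 3 * x * (y - x)\<^sup>2 \<le> y ^ 3 / 3"
proof -
  have "y ^ 3 / 3 - (x ^ 3 / 3 + x\<^sup>2 * (y - x) + 2 / 3 * x * (y - x)\<^sup>2) = y * (y - x)\<^sup>2 / 3"
    by (simp add: power2_eq_square power3_eq_cube field_simps)
  moreover have "y * (y - x)\<^sup>2 / 3 \<ge> 0"
    using assms by simp
  ultimately show ?thesis by linarith
qed

text \<open>
  The quadratic term on the left comes from the summand \<open>2 * x ^ 3 / 3\<close> of \<^term>\<open>psi\<close>. The cube of
  \<open>x + y\<close> only lies above its tangent: its quadratic term degenerates in the direction \<open>(1, -1)\<close> and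
  would not control a single coordinate.
\<close>
lemma psi_lower_quadratic:
  assumes "x \<ge> 0" "y \<ge> 0" "x' \<ge> 0" "y' \<ge> 0"
  shows "psi x y + ((x + y)\<^sup>2 + 2 * x\<^sup>2 - 6) * (x' - x) + ((x + y)\<^sup>2 - 4) * (y' - y)
           + 4 / 3 * x * (x' - x)\<^sup>2 \<le> psi x' y'"
proof -
  have "(x + y) ^ 3 / 3 + (x + y)\<^sup>2 * ((x' + y') - (x + y)) \<le> (x' + y') ^ 3 / 3"
  proof -
    have "0 \<le> 2 / 3 * (x + y) * ((x' + y') - (x + y))\<^sup>2"
      using assms by simp
    then show ?thesis
      using cube_lower_quadratic[of "x + y" "x' + y'"] assms by linarith
  qed
  moreover note cube_lower_quadratic[of x x'] assms
  ultimately show ?thesis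
    by (simp add: psi_def algebra_simps)
qed

lemma psi_ge_square: "4 / 3 * (x - 1)\<^sup>2 \<le> psi x y" if "x \<ge> 0" "y \<ge> 0"
  using psi_lower_quadratic[of 1 1 x y] that by (simp add: psi_def)

text \<open>
  The inequalities for the individual terms are added up. The derivative of \<^term>\<open>psi\<close> in its second
  argument at step \<open>n\<close> is the part of the gradient at index \<open>Suc n\<close> that comes from the left; it
  stays behind as the boundary term until the next step completes it to \<^term>\<open>grad v (Suc n)\<close>.
\<close>
lemma J_part_lower:
  assumes v: "\<And>j. v j \<ge> 0" and w: "\<And>j. w j \<ge> 0"
  shows "J_part n v
           + (\<Sum>j<n. grad v j * (w j - v j) + 4 / 3 * v j * (w j - v j)\<^sup>2)
           + (incoming v n - 4) * (w n - v n) \<le> J_part n w"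
proof (induction n)
  case 0
  have "0 \<le> 2 / 3 * v 0 * (w 0 - v 0)\<^sup>2"
    using v by simp
  then show ?case
    using cube_lower_quadratic[OF v[of 0] w[of 0]]
    by (simp add: J_part_def b_def algebra_simps)
next
  case (Suc n)
  show ?case
    using Suc psi_lower_quadratic[OF v[of n] v[of "Suc n"] w[of n] w[of "Suc n"]]
    by (simp add: J_part_def grad_def algebra_simps)
qed

section \<open>Critical sequences: uniqueness, convergence and two-sided bounds\<close>

lemma stationary_iff_grad:
  "stationary_sequence w \<longleftrightarrow> (\<forall>j. w j > 0) \<and> (\<forall>j. grad w j = 0) \<and> w \<longlonglongrightarrow> 1"
proof -
  have "(\<forall>j. grad w j = 0) \<longleftrightarrow> grad w 0 = 0 \<and> (\<forall>j\<ge>1. grad w j = 0)"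
    by (metis One_nat_def Suc_leI bot_nat_0.not_eq_extremum)
  moreover have "grad w 0 = 0 \<longleftrightarrow> 3 * (w 0)\<^sup>2 + (w 0 + w 1)\<^sup>2 = 10"
    by (auto simp: grad_def)
  moreover have "grad w j = 0 \<longleftrightarrow>
      (w (j - 1) + w j)\<^sup>2 + (w j + w (j + 1))\<^sup>2 + 2 * (w j)\<^sup>2 = 10" if "j \<ge> 1" for j
    using that by (cases j) (auto simp: grad_def)
  ultimately show ?thesis
    unfolding stationary_sequence_def by auto
qed

lemma incoming_tendsto:
  assumes "w \<longlonglongrightarrow> 1"
  shows "incoming w \<longlonglongrightarrow> 4"
proof -
  have "(\<lambda>n. (w n + w (Suc n))\<^sup>2) \<longlonglongrightarrow> (1 + 1)\<^sup>2"
    by (intro tendsto_intros assms LIMSEQ_Suc)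
  then have "(\<lambda>n. incoming w (Suc n)) \<longlonglongrightarrow> 4"
    by simp
  then show ?thesis
    by (rule LIMSEQ_imp_Suc)
qed

lemma incoming_nonneg: "incoming w j \<ge> 0"
  by (cases j) auto

text \<open>
  Adding \<open>J_part_lower\<close> for \<open>(v, w)\<close> and for \<open>(w, v)\<close> cancels the functional. What remains bounds a
  positive multiple of \<open>(w j - v j)\<^sup>2\<close> by a boundary term, which tends to 0.
\<close>
lemma stationary_unique:
  assumes "stationary_sequence v" "stationary_sequence w"
  shows "v = w"
proof
  fix j
  have pos: "\<And>i. v i > 0" "\<And>i. w i > 0" and g: "\<And>i. grad v i = 0" "\<And>i. grad w i = 0"
    and lim: "v \<longlonglongrightarrow> 1" "w \<longlonglongrightarrow> 1"
    using assms by (auto simp: stationary_iff_grad)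
  let ?q = "\<lambda>v w j. 4 / 3 * v j * (w j - v j)\<^sup>2 :: real"
  have *: "?q v w j + ?q w v j \<le> (incoming w n - incoming v n) * (w n - v n)" if "n > j" for n
  proof -
    have "?q v w j \<le> (\<Sum>i<n. ?q v w i)" "?q w v j \<le> (\<Sum>i<n. ?q w v i)"
      using that pos by (intro member_le_sum; simp add: less_imp_le)+
    moreover have "J_part n v + (\<Sum>i<n. ?q v w i) + (incoming v n - 4) * (w n - v n) \<le> J_part n w"
      using J_part_lower[of v w n] pos by (simp add: g less_imp_le)
    moreover have "J_part n w + (\<Sum>i<n. ?q w v i) + (incoming w n - 4) * (v n - w n) \<le> J_part n v"
      using J_part_lower[of w v n] pos by (simp add: g less_imp_le)
    ultimately show ?thesis
      by (simp add: algebra_simps)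
  qed
  have "(\<lambda>n. (incoming w n - incoming v n) * (w n - v n)) \<longlonglongrightarrow> (4 - 4) * (1 - 1)"
    by (intro tendsto_intros incoming_tendsto lim)
  moreover have "\<forall>\<^sub>F n in sequentially.
      ?q v w j + ?q w v j \<le> (incoming w n - incoming v n) * (w n - v n)"
    using eventually_gt_at_top[of j] by eventually_elim (rule *)
  ultimately have zero: "?q v w j + ?q w v j \<le> (4 - 4) * (1 - 1)"
    using tendsto_lowerbound sequentially_bot by blast
  have "?q v w j + ?q w v j = 4 / 3 * (v j + w j) * (w j - v j)\<^sup>2"
    by (simp add: power2_commute[of "v j"] algebra_simps)
  then have le: "4 / 3 * (v j + w j) * (w j - v j)\<^sup>2 \<le> 0"
    using zero by (simp only: diff_self mult_zero_left)
  show "v j = w j"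
  proof (rule ccontr)
    assume "v j \<noteq> w j"
    then have "0 < 4 / 3 * (v j + w j) * (w j - v j)\<^sup>2"
      using pos[of j] by (intro mult_pos_pos) auto
    with le show False by simp
  qed
qed

text \<open>
  The vanishing gradient alone bounds the entries and hence the boundary term, so comparison with the
  constant sequence 1, for which the truncated functional is 0, bounds all partial sums. Convergence
  to 1 follows because the terms of a convergent series tend to 0 and dominate \<open>4 / 3 * (w j - 1)\<^sup>2\<close>.
\<close>
lemma critical_imp_summable:
  assumes nonneg: "\<And>j. w j \<ge> 0" and crit: "\<And>j. grad w j = 0"
  shows "summable (\<lambda>j. psi (w j) (w (Suc j)))" and "w \<longlonglongrightarrow> 1"
proof -
  have psi: "4 / 3 * (w j - 1)\<^sup>2 \<le> psi (w j) (w (Suc j))" for j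
    using psi_ge_square nonneg by blast
  have psi0: "0 \<le> psi (w j) (w (Suc j))" for j
    by (rule order_trans[OF _ psi]) simp
  have "(\<Sum>j<n. psi (w j) (w (Suc j))) \<le> 12 - b (w 0)" for n
  proof -
    have "(w n)\<^sup>2 \<le> 3\<^sup>2" "incoming w n \<le> 10"
      using crit[of n] incoming_nonneg[of w n] incoming_nonneg[of w "Suc n"]
        zero_le_power2[of "w n"]
      unfolding grad_def power2_eq_square[of 3] by linarith+
    then have "w n \<le> 3"
      using power2_le_imp_le[of "w n" 3] by simp
    have "- 12 \<le> (incoming w n - 4) * (1 - w n)"
    proof -
      have "\<bar>incoming w n - 4\<bar> * \<bar>1 - w n\<bar> \<le> 6 * 2"
        using \<open>w n \<le> 3\<close> \<open>incoming w n \<le> 10\<close> incoming_nonneg[of w n] nonneg[of n]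
        by (intro mult_mono) auto
      then show ?thesis
        by (simp add: abs_mult[symmetric])
    qed
    moreover have "(\<Sum>j<n. 4 / 3 * w j * (1 - w j)\<^sup>2) \<ge> 0"
      using nonneg by (intro sum_nonneg) simp
    moreover have "J_part n (\<lambda>_. 1) = 0"
      by (simp add: J_part_def b_def psi_def)
    ultimately show ?thesis
      using J_part_lower[of w "\<lambda>_. 1" n] nonneg by (simp add: crit J_part_def[of n w])
  qed
  then show sum: "summable (\<lambda>j. psi (w j) (w (Suc j)))"
    using psi0 by (intro bounded_imp_summable) (simp_all only: lessThan_Suc_atMost[symmetric])
  have "(\<lambda>j. 4 / 3 * (w j - 1)\<^sup>2) \<longlonglongrightarrow> 0"
    by (rule tendsto_sandwich[OF _ _ tendsto_const summable_LIMSEQ_zero[OF sum]])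
       (use psi in auto)
  then have "(\<lambda>j. 3 / 4 * (4 / 3 * (w j - 1)\<^sup>2)) \<longlonglongrightarrow> 3 / 4 * 0"
    by (intro tendsto_intros)
  then have "(\<lambda>j. (w j - 1)\<^sup>2) \<longlonglongrightarrow> 0"
    by simp
  then have "(\<lambda>j. w j - 1) \<longlonglongrightarrow> 0"
    by simp
  then show "w \<longlonglongrightarrow> 1"
    by (simp add: LIM_zero_iff)
qed

lemma J_part_tendsto:
  assumes "summable (\<lambda>j. psi (w j) (w (Suc j)))"
  shows "(\<lambda>n. J_part n w) \<longlonglongrightarrow> J w"
  unfolding J_part_def J_def by (intro tendsto_intros summable_LIMSEQ assms)

lemma J_eventually_one:
  assumes "\<And>j. j \<ge> N \<Longrightarrow> v j = 1" "n \<ge> N"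
  shows "J_part n v = J v"
proof -
  have "(\<Sum>j. psi (v j) (v (Suc j))) = (\<Sum>j<n. psi (v j) (v (Suc j)))"
    using assms by (intro suminf_finite) (auto simp: psi_def)
  then show ?thesis
    by (simp add: J_part_def J_def)
qed

lemma J_critical_le:
  assumes nonneg: "\<And>j. w j \<ge> 0" and crit: "\<And>j. grad w j = 0"
    and v: "\<And>j. v j \<ge> 0" and one: "\<And>j. j \<ge> N \<Longrightarrow> v j = 1"
  shows "J w \<le> J v"
proof -
  have "J_part n w + (incoming w n - 4) * (1 - w n) \<le> J v" if "n \<ge> N" for n
  proof -
    have "(\<Sum>j<n. 4 / 3 * w j * (v j - w j)\<^sup>2) \<ge> 0"
      using nonneg by (intro sum_nonneg) simp
    then show ?thesis
      using J_part_lower[of w v n, OF nonneg v] that J_eventually_one[of N v n, OF one]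
      by (simp add: crit one)
  qed
  moreover have "(\<lambda>n. J_part n w + (incoming w n - 4) * (1 - w n)) \<longlonglongrightarrow> J w + (4 - 4) * (1 - 1)"
    by (intro tendsto_intros J_part_tendsto incoming_tendsto critical_imp_summable[OF nonneg crit])
  ultimately have "J w + (4 - 4) * (1 - 1) \<le> J v"
    by (intro tendsto_upperbound[where F = sequentially])
       (auto intro!: eventually_sequentiallyI[of N])
  then show ?thesis by simp
qed

text \<open>The square is completed at the minimizer \<open>h = - 3 / (8 * m) * g\<close>.\<close>
lemma linear_quadratic_ge:
  fixes g h m x :: real
  assumes "0 < m" "m \<le> x"
  shows "- (3 / (16 * m) * g\<^sup>2) \<le> g * h + 4 / 3 * x * h\<^sup>2"
proof -
  have "0 \<le> 4 / 3 * m * (h + 3 / (8 * m) * g)\<^sup>2"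
    using assms by simp
  also have "\<dots> = g * h + 4 / 3 * m * h\<^sup>2 + 3 / (16 * m) * g\<^sup>2"
    using assms by (simp add: power2_eq_square field_simps)
  also have "\<dots> \<le> g * h + 4 / 3 * x * h\<^sup>2 + 3 / (16 * m) * g\<^sup>2"
    using assms by (simp add: mult_right_mono)
  finally show ?thesis by simp
qed

text \<open>
  Here the base point is the trial sequence: its gradient is not 0, but the quadratic gain absorbs
  the linear term at a cost that no longer involves \<open>w\<close>. The sum runs up to \<open>N\<close>, since the
  equation at \<open>N\<close> still sees \<^term>\<open>v (N - 1)\<close>; beyond \<open>N\<close> both the gradient and the boundary term
  vanish.
\<close>
lemma J_critical_ge:
  assumes nonneg: "\<And>j. w j \<ge> 0" and crit: "\<And>j. grad w j = 0"
    and v: "\<And>j. m \<le> v j" "0 < m" and one: "\<And>j. j \<ge> N \<Longrightarrow> v j = 1"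
  shows "J v - 3 / (16 * m) * (\<Sum>j\<le>N. (grad v j)\<^sup>2) \<le> J w"
proof -
  have v0: "v j \<ge> 0" for j
    using v by (meson less_imp_le order_trans)
  have "J v - 3 / (16 * m) * (\<Sum>j\<le>N. (grad v j)\<^sup>2) \<le> J_part n w"
    if n: "n \<ge> Suc N" for n
  proof -
    obtain k where k: "n = Suc k"
      using n by (cases n) simp_all
    have inc: "incoming v (Suc i) = 4" if "i \<ge> N" for i
      using that by (simp add: one)
    have grad0: "grad v j = 0" if "j > N" for j
      using that inc[of j] inc[of "j - 1"] by (simp add: grad_def one)
    have "(\<Sum>j\<le>N. (grad v j)\<^sup>2) = (\<Sum>j<n. (grad v j)\<^sup>2)"
      using n by (intro sum.mono_neutral_left) (auto simp: grad0)
    then have "- (3 / (16 * m) * (\<Sum>j\<le>N. (grad v j)\<^sup>2)) = (\<Sum>j<n. - (3 / (16 * m) * (grad v j)\<^sup>2))"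
      by (simp add: sum_distrib_left sum_negf)
    also have "\<dots> \<le> (\<Sum>j<n. grad v j * (w j - v j) + 4 / 3 * v j * (w j - v j)\<^sup>2)"
      using v by (intro sum_mono linear_quadratic_ge) auto
    finally show ?thesis
      using J_part_lower[of v w n, OF v0 nonneg] J_eventually_one[of N v n, OF one] n k inc[of k]
      by simp
  qed
  moreover have "(\<lambda>n. J_part n w) \<longlonglongrightarrow> J w"
    by (intro J_part_tendsto critical_imp_summable[OF nonneg crit])
  ultimately show ?thesis
    by (intro tendsto_lowerbound[where F = sequentially])
       (auto intro!: eventually_sequentiallyI[of "Suc N"])
qed

section \<open>Existence of a positive critical sequence\<close>

definition descend :: "(nat \<Rightarrow> real) \<Rightarrow> nat \<Rightarrow> real" where
  "descend w j = w j - grad w j / 20"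

definition in_box :: "(nat \<Rightarrow> real) \<Rightarrow> bool" where
  "in_box w \<longleftrightarrow> (\<forall>j. w j \<in> {1/2..8/5})"

text \<open>
  The bound \<open>27 / 5\<close> fits its use below, where \<open>p\<close> and \<open>q\<close> are a sum of two neighbours, at most
  \<open>16 / 5\<close>, and the extreme value \<open>1 / 2 + 8 / 5 = 21 / 10\<close>.
\<close>
lemma square_increment_le:
  fixes p q \<delta> :: real
  assumes "0 \<le> p" "0 \<le> q" "p + q \<le> 27 / 5" "p - q \<le> \<delta>" "0 \<le> \<delta>"
  shows "p\<^sup>2 - q\<^sup>2 \<le> 27 / 5 * \<delta>"
proof -
  have "p\<^sup>2 - q\<^sup>2 = (p + q) * (p - q)"
    by (simp add: power2_eq_square algebra_simps)
  also have "\<dots> \<le> (p + q) * \<delta>"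
    using assms by (intro mult_left_mono) auto
  also have "\<dots> \<le> 27 / 5 * \<delta>"
    using assms by (intro mult_right_mono) auto
  finally show ?thesis .
qed

text \<open>
  The gradient at \<open>j\<close> increases with all three entries that it involves. If the entry is \<open>1 / 2\<close> and
  its neighbours are \<open>8 / 5\<close>, the gradient is still negative; in the opposite corner it is still
  positive. Between these, it changes less than 20 times as fast as the entry, so a step of length
  \<open>1 / 20\<close> does not overshoot.
\<close>
lemma descend_in_box:
  assumes "in_box w"
  shows "in_box (descend w)"
  unfolding in_box_def
proof
  fix j
  have box: "1/2 \<le> w i" "w i \<le> 8/5" for i
    using assms by (auto simp: in_box_def)
  have *: "(w i + w k)\<^sup>2 \<le> (21/10)\<^sup>2 + 27/5 * (w i - 1/2)"
       "(21/10)\<^sup>2 \<le> (w i + w k)\<^sup>2 + 27/5 * (8/5 - w i)" for i k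
    using square_increment_le[of "w i + w k" "21/10" "w i - 1/2"]
      square_increment_le[of "21/10" "w i + w k" "8/5 - w i"] box[of i] box[of k]
    by linarith+
  have sq: "(w i)\<^sup>2 \<le> (1/2)\<^sup>2 + 21/10 * (w i - 1/2)" "(8/5)\<^sup>2 \<le> (w i)\<^sup>2 + 16/5 * (8/5 - w i)" for i
  proof -
    have "(w i)\<^sup>2 = (1/2)\<^sup>2 + 21/10 * (w i - 1/2) - (w i - 1/2) * (8/5 - w i)"
      "(8/5)\<^sup>2 = (w i)\<^sup>2 + 16/5 * (8/5 - w i) - (8/5 - w i)\<^sup>2"
      by (simp_all add: power2_eq_square field_simps)
    moreover have "(w i - 1/2) * (8/5 - w i) \<ge> 0" "(8/5 - w i)\<^sup>2 \<ge> 0"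
      using box[of i] by auto
    ultimately show "(w i)\<^sup>2 \<le> (1/2)\<^sup>2 + 21/10 * (w i - 1/2)"
      "(8/5)\<^sup>2 \<le> (w i)\<^sup>2 + 16/5 * (8/5 - w i)"
      by linarith+
  qed
  have num: "(21/10 :: real)\<^sup>2 = 441/100" "(1/2 :: real)\<^sup>2 = 1/4" "(8/5 :: real)\<^sup>2 = 64/25"
    by (simp_all add: power_divide)
  show "descend w j \<in> {1/2..8/5}"
  proof (cases j)
    case 0
    then show ?thesis
      using *[of 0 1, unfolded num] sq[of 0, unfolded num] box[of 0]
      by (simp add: descend_def grad_def field_simps)
  next
    case (Suc i)
    then show ?thesis
      using *[of j i, unfolded num] *[of j "Suc j", unfolded num] sq[of j, unfolded num] box[of j]
      by (simp add: descend_def grad_def field_simps)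
  qed
qed

lemma abs_weighted_le:
  fixes A B C x y z d :: real
  assumes "0 \<le> A" "0 \<le> B" "0 \<le> C" "\<bar>x\<bar> \<le> d" "\<bar>y\<bar> \<le> d" "\<bar>z\<bar> \<le> d"
  shows "\<bar>C * y - A * x - B * z\<bar> \<le> (A + B + C) * d"
proof -
  have "\<bar>C * y\<bar> \<le> C * d" "\<bar>A * x\<bar> \<le> A * d" "\<bar>B * z\<bar> \<le> B * d"
    using assms by (auto simp: abs_mult intro: mult_left_mono)
  then show ?thesis by (simp add: algebra_simps)
qed

text \<open>
  Differences of squares factor, so the difference of two gradient steps is exactly
  \<open>C * h j - A * h (j - 1) - B * h (j + 1)\<close> with nonnegative coefficients. Their sum is
  \<open>1 - 2 * (w j + v j) / 20\<close>, or \<open>1 - 3 * (w 0 + v 0) / 20\<close> at the left end, because the couplings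
  \<open>A\<close> and \<open>B\<close> reappear negatively in \<open>C\<close>; the entries are at least \<open>1 / 2\<close>.
\<close>
lemma descend_contraction:
  assumes "in_box v" "in_box w" and d: "\<And>j. \<bar>w j - v j\<bar> \<le> d"
  shows "\<bar>descend w j - descend v j\<bar> \<le> 9 / 10 * d"
proof -
  have box: "1/2 \<le> w i" "w i \<le> 8/5" "1/2 \<le> v i" "v i \<le> 8/5" for i
    using assms by (auto simp: in_box_def)
  have "d \<ge> 0"
    using d[of 0] by linarith
  define B where "B = (w j + w (Suc j) + v j + v (Suc j)) / 20"
  define h where "h i = w i - v i" for i
  have h: "\<bar>h i\<bar> \<le> d" for i
    using d by (simp add: h_def)
  show ?thesis
  proof (cases j)
    case 0
    define C where "C = 1 - B - 3 * (w j + v j) / 20"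
    have "descend w j - descend v j = C * h j - 0 * h j - B * h (Suc j)"
      by (simp add: C_def B_def h_def 0 descend_def grad_def power2_eq_square field_simps)
    also have "\<bar>\<dots>\<bar> \<le> (0 + B + C) * d"
      using box[of j] box[of "Suc j"] h by (intro abs_weighted_le; simp add: B_def C_def field_simps)
    also have "\<dots> \<le> 9 / 10 * d"
      using box[of j] \<open>d \<ge> 0\<close> by (intro mult_right_mono) (auto simp: C_def)
    finally show ?thesis .
  next
    case (Suc i)
    define A where "A = (w i + w j + v i + v j) / 20"
    define C where "C = 1 - A - B - 2 * (w j + v j) / 20"
    have "descend w j - descend v j = C * h j - A * h i - B * h (Suc j)"
      by (simp add: A_def B_def C_def h_def Suc descend_def grad_def power2_eq_square field_simps)
    also have "\<bar>\<dots>\<bar> \<le> (A + B + C) * d"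
      using box[of i] box[of j] box[of "Suc j"] h
      by (intro abs_weighted_le; simp add: A_def B_def C_def field_simps)
    also have "\<dots> \<le> 9 / 10 * d"
      using box[of j] \<open>d \<ge> 0\<close> by (intro mult_right_mono) (auto simp: C_def)
    finally show ?thesis .
  qed
qed

lemma convergent_of_geometric_increments:
  fixes x :: "nat \<Rightarrow> real"
  assumes "\<And>n. \<bar>x (Suc n) - x n\<bar> \<le> C * r ^ n" "0 \<le> r" "r < 1"
  shows "convergent x"
proof -
  have "summable (\<lambda>n. C * r ^ n)"
    using assms by (intro summable_mult summable_geometric) auto
  then have "summable (\<lambda>n. x (Suc n) - x n)"
    by (rule summable_comparison_test[rotated]) (use assms in auto)
  then have "convergent (\<lambda>n. \<Sum>k<n. x (Suc k) - x k)"
    by (simp add: summable_iff_convergent)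
  then have "convergent (\<lambda>n. x n - x 0)"
    by (simp only: sum_lessThan_telescope)
  then have "convergent (\<lambda>n. (x n - x 0) + x 0)"
    by (intro convergent_add convergent_const)
  then show ?thesis by simp
qed

text \<open>
  The coordinates of the iterates converge geometrically, and pointwise convergence suffices to pass
  to the limit because each coordinate of \<^term>\<open>grad\<close> involves only three entries.
\<close>
lemma critical_sequence_exists:
  obtains w where "\<And>j. w j > 0" "\<And>j. grad w j = 0"
proof -
  define W where "W n = (descend ^^ n) (\<lambda>_. 1)" for n
  have W_Suc: "W (Suc n) = descend (W n)" for n
    by (simp add: W_def)
  have box: "in_box (W n)" for n
  proof (induction n)
    case 0
    then show ?case by (simp add: W_def in_box_def)
  next
    case (Suc n)
    then show ?case by (simp add: W_Suc descend_in_box)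
  qed
  have step: "\<bar>W (Suc n) j - W n j\<bar> \<le> 11 / 10 * (9 / 10) ^ n" for n j
  proof (induction n arbitrary: j)
    case 0
    show ?case
    proof -
      have "W 0 j \<in> {1/2..8/5}" "W (Suc 0) j \<in> {1/2..8/5}"
        using box unfolding in_box_def by blast+
      then have "\<bar>W (Suc 0) j - W 0 j\<bar> \<le> 11 / 10"
        unfolding atLeastAtMost_iff by linarith
      then show ?thesis by simp
    qed
  next
    case (Suc n)
    show ?case
      using descend_contraction[OF box box Suc] by (simp add: W_Suc)
  qed
  have "convergent (\<lambda>n. W n j)" for j
    by (rule convergent_of_geometric_increments[OF step]) auto
  then obtain w where w: "(\<lambda>n. W n j) \<longlonglongrightarrow> w j" for j
    unfolding convergent_def by metis
  have "1/2 \<le> w j" for j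
    by (rule tendsto_lowerbound[OF w]) (use box in \<open>auto simp: in_box_def\<close>)
  then have pos: "w j > 0" for j
    by (smt (verit) divide_pos_pos)
  have "(\<lambda>n. incoming (W n) j) \<longlonglongrightarrow> incoming w j" for j
    by (cases j) (auto intro!: tendsto_intros w)
  then have "(\<lambda>n. grad (W n) j) \<longlonglongrightarrow> grad w j" for j
    unfolding grad_def by (intro tendsto_intros w)
  then have "(\<lambda>n. descend (W n) j) \<longlonglongrightarrow> w j - grad w j / 20" for j
    unfolding descend_def by (intro tendsto_intros w) auto
  moreover have "(\<lambda>n. descend (W n) j) \<longlonglongrightarrow> w j" for j
    using LIMSEQ_Suc[OF w[of j]] by (simp add: W_Suc)
  ultimately have "w j - grad w j / 20 = w j" for j
    by (metis LIMSEQ_unique)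
  then have "grad w j = 0" for j
    by simp
  with pos show thesis using that by blast
qed

section \<open>The trial sequence\<close>

text \<open>
  These are the entries of the minimizer rounded to 16 decimals, found numerically by Newton's method;
  only the residual computed below vouches for them. Integers over a common denominator keep all
  evaluations free of fractions.
\<close>
definition trial_numerator :: "nat \<Rightarrow> int" where
  "trial_numerator j = (if j < 34 then
    [13173876830047039, 8720115674753207, 10478120114964491, 9815862743882009,
     10070110627099426, 9973187679431254, 10010236652176822, 9996089255338679,
     10001493670627132, 9999429453867185, 10000217927082693, 9999916758948112,
     10000031795206842, 9999987855304995, 10000004638859736, 9999998228113108,
     10000000676800548, 9999999741485191, 10000000098743870, 9999999962283198,
     10000000014406536, 9999999994497193, 10000000002101885, 9999999999197151,
     10000000000306661, 9999999999882866, 10000000000044741, 9999999999982910,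
     10000000000006528, 9999999999997507, 10000000000000952, 9999999999999636,
     10000000000000139, 9999999999999947] ! j
    else 10 ^ 16)"

definition trial :: "nat \<Rightarrow> real" where
  "trial j = of_int (trial_numerator j) / 10 ^ 16"

lemma trial_eq_one: "j \<ge> 34 \<Longrightarrow> trial j = 1"
  by (simp add: trial_def trial_numerator_def)

lemma trial_ge: "1 / 2 \<le> trial j"
proof -
  have "\<forall>j\<in>{..<34}. 10 ^ 16 \<le> 2 * trial_numerator j"
    by (simp add: trial_numerator_def lessThan_nat_numeral)
  then have "10 ^ 16 \<le> 2 * trial_numerator j"
    by (cases "j < 34") (auto simp: trial_numerator_def)
  then have "real_of_int (10 ^ 16) \<le> real_of_int (2 * trial_numerator j)"
    by (simp only: of_int_le_iff)
  then show ?thesis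
    by (simp add: trial_def)
qed

lemma J_part_common_denominator:
  fixes x :: "nat \<Rightarrow> int" and S :: int
  assumes "S \<noteq> 0"
  shows "3 * of_int S ^ 3 * J_part n (\<lambda>j. of_int (x j) / of_int S) =
    of_int (x 0 ^ 3 - 12 * S\<^sup>2 * x 0 + 11 * S ^ 3
      + (\<Sum>j<n. (x j + x (Suc j)) ^ 3 + 2 * x j ^ 3
               - S\<^sup>2 * (18 * x j + 12 * x (Suc j)) + 20 * S ^ 3))"
proof (induction n)
  case 0
  show ?case
    using assms by (simp add: J_part_def b_def power2_eq_square power3_eq_cube field_simps)
next
  case (Suc n)
  have "3 * of_int S ^ 3 * psi (of_int (x n) / of_int S) (of_int (x (Suc n)) / of_int S) =
    of_int ((x n + x (Suc n)) ^ 3 + 2 * x n ^ 3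
               - S\<^sup>2 * (18 * x n + 12 * x (Suc n)) + 20 * S ^ 3)"
    using assms
    by (simp add: psi_def power2_eq_square power3_eq_cube add_divide_distrib[symmetric] field_simps)
  moreover have "J_part (Suc n) w = J_part n w + psi (w n) (w (Suc n))" for w
    by (simp add: J_part_def)
  ultimately show ?case
    using Suc by (simp only: distrib_left of_int_add sum.lessThan_Suc)
qed

lemma grad_common_denominator:
  fixes x :: "nat \<Rightarrow> int" and S :: int
  assumes "S \<noteq> 0"
  shows "of_int S ^ 2 * grad (\<lambda>j. of_int (x j) / of_int S) j =
    of_int ((if j = 0 then x 0 else x (j - 1) + x j)\<^sup>2 + (x j + x (Suc j))\<^sup>2
      + 2 * (x j)\<^sup>2 - 10 * S\<^sup>2)"
  using assms
  by (cases j) (simp_all add: grad_def power2_eq_square add_divide_distrib[symmetric] field_simps)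

lemma J_trial:
  "3 * 10 ^ 48 * J trial = -1477360790880407322474938487158550615788826485400"
proof -
  define S :: int where "S = 10 ^ 16"
  let ?x = trial_numerator
  have "?x 0 ^ 3 - 12 * S\<^sup>2 * ?x 0 + 11 * S ^ 3
      + (\<Sum>j<34. (?x j + ?x (Suc j)) ^ 3 + 2 * ?x j ^ 3
               - S\<^sup>2 * (18 * ?x j + 12 * ?x (Suc j)) + 20 * S ^ 3) = -1477360790880407322474938487158550615788826485400"
    by (simp add: S_def trial_numerator_def lessThan_nat_numeral)
  moreover have "trial = (\<lambda>j. of_int (?x j) / of_int S)"
    by (simp add: S_def trial_def[abs_def])
  ultimately have "3 * of_int S ^ 3 * J_part 34 trial = of_int (-1477360790880407322474938487158550615788826485400)"
    using J_part_common_denominator[of S 34 ?x] by (simp add: S_def del: of_int_add of_int_diff)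
  then show ?thesis
    using J_eventually_one[of 34 trial 34, OF trial_eq_one] by (simp add: S_def)
qed

lemma residual_trial:
  "10 ^ 64 * (\<Sum>j\<le>34. (grad trial j)\<^sup>2) = 5164094328596646671839276257345535989"
proof -
  define S :: int where "S = 10 ^ 16"
  let ?x = trial_numerator
  have eq: "(\<Sum>j\<le>34. ((if j = 0 then ?x 0 else ?x (j - 1) + ?x j)\<^sup>2 + (?x j + ?x (Suc j))\<^sup>2
      + 2 * (?x j)\<^sup>2 - 10 * S\<^sup>2)\<^sup>2) = 5164094328596646671839276257345535989"
    by (simp add: S_def trial_numerator_def atMost_nat_numeral)
  have "10 ^ 64 * (\<Sum>j\<le>34. (grad trial j)\<^sup>2) = (\<Sum>j\<le>34. (of_int S ^ 2 * grad trial j)\<^sup>2)"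
    by (simp add: sum_distrib_left power_mult_distrib S_def)
  also have "\<dots> = of_int (\<Sum>j\<le>34. ((if j = 0 then ?x 0 else ?x (j - 1) + ?x j)\<^sup>2
      + (?x j + ?x (Suc j))\<^sup>2 + 2 * (?x j)\<^sup>2 - 10 * S\<^sup>2)\<^sup>2)"
    using grad_common_denominator[of S ?x] by (simp add: S_def trial_def[abs_def])
  finally show ?thesis
    unfolding eq by simp
qed

section \<open>The enclosure\<close>

theorem proposition9p2:
  shows "0.1150549835233248474484387814301602327073195692204367998530110 < q_star
    \<and> q_star < 0.1150549835233248474484387815240548332602930857594706272107345"
proof -
  obtain w where pos: "\<And>j. w j > 0" and crit: "\<And>j. grad w j = 0"
    using critical_sequence_exists by blast
  have nonneg: "w j \<ge> 0" for j
    using pos[of j] by simp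
  have "stationary_sequence w"
    using pos crit critical_imp_summable(2)[OF nonneg crit] by (simp add: stationary_iff_grad)
  then have w_star: "w_star = w"
    unfolding w_star_def by (metis (mono_tags) stationary_unique the_equality)
  have trial_nonneg: "trial j \<ge> 0" for j
    using trial_ge[of j] by simp
  have "J w \<le> J trial"
    by (rule J_critical_le[OF nonneg crit trial_nonneg trial_eq_one])
  \<comment> \<open>All trial entries are at least \<open>1 / 2\<close>, so the constant is \<open>3 / (16 * (1 / 2)) = 3 / 8\<close>.\<close>
  moreover have "J trial - 3 / 8 * (\<Sum>j\<le>34. (grad trial j)\<^sup>2) \<le> J w"
    using J_critical_ge[OF nonneg crit trial_ge _ trial_eq_one] by simp
  ultimately show ?thesis
    using J_trial residual_trial unfolding q_star_def w_star by simp
qed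

end
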